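(* Let $r,s,t$ be positive integers with $r \ge 2$ and $t \ge s \ge 2$. Then there is a constant $C = C(r,s,t)$ such that, if $n$ is large enough, every $2$-edge-coloring $E(K_n) = E(R)\cup E(B)$ with $\min\{e(R),e(B)\}\ge Cn$ that contains no monochromatic induced $rK_2$ contains an induced monochromatic member of $\mathcal{F}_{s,t} = \{K_{s,t}, S_{t,t}\}$.
   Context: A $2$-edge-coloring of $K_n$ is a partition $E(K_n)=E(R)\cup E(B)$ into red and blue edges; $e(R),e(B)$ are the numbers of red and blue edges. The coloring contains an induced monochromatic copy of a graph $H$ if there is $U\subseteq V(K_n)$ with $|U|=|V(H)|$ such that the red edges inside $U$, or the blue edges inside $U$, form a graph isomorphic to $H$. $rK_2$ is the matching with $r$ edges (disjoint union of $r$ copies of $K_2$). $K_{s,t}$ is the complete bipartite graph with parts of sizes $s,t$; $S_{t,t}$ is the complete split graph consisting of a clique on $t$ vertices, an independent set on $t$ vertices, and all edges between them. *)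

theory Defs
  imports Complex_Main
begin

(* A simple graph is a pair of a vertex set and a set of two-element subsets of it. *)
type_synonym 'a graph = "'a set \<times> 'a set set"

definition all_pairs :: "'a set \<Rightarrow> 'a set set" where
  "all_pairs V = {e. e \<subseteq> V \<and> card e = 2}"

definition graph_iso :: "'a graph \<Rightarrow> 'b graph \<Rightarrow> bool" where
  "graph_iso G H \<longleftrightarrow>
    (\<exists>f. bij_betw f (fst G) (fst H) \<and>
      (\<forall>x \<in> fst G. \<forall>y \<in> fst G. {x, y} \<in> snd G \<longleftrightarrow> {f x, f y} \<in> snd H))"

definition matching_graph :: "nat \<Rightarrow> nat graph" where
  "matching_graph r = ({..<2 * r}, {{2 * i, 2 * i + 1} | i. i < r})"

definition complete_bipartite :: "nat \<Rightarrow> nat \<Rightarrow> nat graph" where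
  "complete_bipartite s t = ({..<s + t}, {{i, j} | i j. i < s \<and> s \<le> j \<and> j < s + t})"

(* Clique on the first s vertices, independent set on the other t, all edges in between. *)
definition complete_split :: "nat \<Rightarrow> nat \<Rightarrow> nat graph" where
  "complete_split s t =
    ({..<s + t}, all_pairs {..<s} \<union> {{i, j} | i j. i < s \<and> s \<le> j \<and> j < s + t})"

definition family_F :: "nat \<Rightarrow> nat \<Rightarrow> nat graph set" where
  "family_F s t = {complete_bipartite s t, complete_split t t}"

(* K_n has vertex set {..<n}; R and B are the red and the blue edges. *)
definition two_edge_coloring :: "nat \<Rightarrow> nat set set \<Rightarrow> nat set set \<Rightarrow> bool" where
  "two_edge_coloring n R B \<longleftrightarrow> R \<union> B = all_pairs {..<n} \<and> R \<inter> B = {}"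

definition has_induced_mono ::
  "nat \<Rightarrow> nat set set \<Rightarrow> nat set set \<Rightarrow> 'b graph \<Rightarrow> bool" where
  "has_induced_mono n R B H \<longleftrightarrow>
    (\<exists>U \<subseteq> {..<n}. card U = card (fst H) \<and>
      (graph_iso (U, {e \<in> R. e \<subseteq> U}) H \<or> graph_iso (U, {e \<in> B. e \<subseteq> U}) H))"

end

theory Submission
  imports Defs "HOL-Library.Ramsey"
begin

text \<open>
  If a colour has at least \<open>2Mn\<close> edges, a greedy choice yields a matching \<open>a\<^sub>i b\<^sub>i\<close>, \<open>i < M\<close>, in it.
  By Ramsey's theorem we may assume that, for \<open>i < j\<close>, the colour of each of \<open>a\<^sub>i a\<^sub>j\<close>, \<open>b\<^sub>i b\<^sub>j\<close>,
  \<open>a\<^sub>i b\<^sub>j\<close>, \<open>b\<^sub>i a\<^sub>j\<close> does not depend on \<open>i, j\<close>. If none of these pairs has the colour of the matching,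
  the matching is induced; if \<open>a\<^sub>i a\<^sub>j\<close> or \<open>b\<^sub>i b\<^sub>j\<close> has it, there is a large clique in that colour;
  otherwise the first \<open>s\<close> indices on one side and the last \<open>t\<close> on the other give an induced
  \<open>K\<^sub>s\<^sub>,\<^sub>t\<close>. So without induced matching and \<open>K\<^sub>s\<^sub>,\<^sub>t\<close> there are large cliques in both colours, which
  share at most one vertex, and a second use of Ramsey's theorem finds \<open>t\<close> vertices in each
  with only one colour in between, that is \<open>S\<^sub>t\<^sub>,\<^sub>t\<close> in one of the colours.
\<close>

section \<open>Colour symmetry and edge membership\<close>

lemma two_edge_coloring_commute: "two_edge_coloring n R B \<longleftrightarrow> two_edge_coloring n B R"
  by (auto simp: two_edge_coloring_def)

lemma has_induced_mono_commute: "has_induced_mono n R B H \<longleftrightarrow> has_induced_mono n B R H"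
  by (auto simp: has_induced_mono_def)

lemma doubleton_in_all_pairs [simp]: "{x, y} \<in> all_pairs V \<longleftrightarrow> x \<in> V \<and> y \<in> V \<and> x \<noteq> y"
  by (auto simp: all_pairs_def card_insert_if)

lemma doubleton_in_Collect_iff: "{x, y} \<in> {{i, j} | i j. P i j} \<longleftrightarrow> P x y \<or> P y x"
  by (auto simp: doubleton_eq_iff)

text \<open>Stated for all \<open>x\<close> and \<open>y\<close>, including \<open>x = y\<close>,
  where \<open>{x, y}\<close> is a singleton and hence not an edge. This is what later turns "all
  cross pairs are red" into disjointness.\<close>

lemma two_edge_coloring_red_iff:
  assumes "two_edge_coloring n R B"
  shows "{x, y} \<in> R \<longleftrightarrow> x < n \<and> y < n \<and> x \<noteq> y \<and> {x, y} \<notin> B"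
  using assms doubleton_in_all_pairs[of x y "{..<n}"]
  unfolding two_edge_coloring_def by (metis Un_iff IntI empty_iff lessThan_iff)

section \<open>Induced copies of the target graphs\<close>

text \<open>The image of \<open>g\<close> serves as the vertex set and the inverse of
  \<open>g\<close> as the isomorphism. Only the red alternative is produced; blue copies come from
  exchanging the colours.\<close>

lemma has_induced_mono_if_embedding:
  assumes inj: "inj_on g (fst H)" and ran: "g ` fst H \<subseteq> {..<n}"
    and edges: "\<And>i j. i \<in> fst H \<Longrightarrow> j \<in> fst H \<Longrightarrow> {g i, g j} \<in> R \<longleftrightarrow> {i, j} \<in> snd H"
  shows "has_induced_mono n R B H"
proof -
  let ?U = "g ` fst H" and ?f = "inv_into (fst H) g"
  have "bij_betw ?f ?U (fst H)"
    using inj by (simp add: bij_betw_inv_into inj_on_imp_bij_betw)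
  moreover have "{x, y} \<in> {e \<in> R. e \<subseteq> ?U} \<longleftrightarrow> {?f x, ?f y} \<in> snd H" if "x \<in> ?U" "y \<in> ?U" for x y
    using that edges inj by auto
  ultimately have "graph_iso (?U, {e \<in> R. e \<subseteq> ?U}) H"
    unfolding graph_iso_def fst_conv snd_conv by blast
  moreover have "card ?U = card (fst H)"
    using inj by (rule card_image)
  ultimately show ?thesis
    unfolding has_induced_mono_def using ran by blast
qed

text \<open>Matches the vertex numbering of \<open>complete_bipartite\<close> and
  \<open>complete_split\<close>, whose first part is an initial segment of the numbers.\<close>

lemma enumerate_disjoint_union:
  assumes "finite X" "finite Y" "X \<inter> Y = {}"
  obtains g :: "nat \<Rightarrow> 'a" where "inj_on g {..<card X + card Y}" "\<And>i. i < card X \<Longrightarrow> g i \<in> X"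
    "\<And>i. card X \<le> i \<Longrightarrow> i < card X + card Y \<Longrightarrow> g i \<in> Y"
proof -
  obtain h k where h: "bij_betw h {..<card X} X" and k: "bij_betw k {..<card Y} Y"
    using assms ex_bij_betw_nat_finite lessThan_atLeast0 by metis
  define g where "g i = (if i < card X then h i else k (i - card X))" for i
  have gX: "g i \<in> X" if "i < card X" for i
    using that h by (auto simp: g_def bij_betw_def)
  have gY: "g i \<in> Y" if "card X \<le> i" "i < card X + card Y" for i
    using that k by (auto simp: g_def bij_betw_def)
  have "i = j" if "g i = g j" "i < card X + card Y" "j < card X + card Y" for i j
  proof (cases "i < card X \<longleftrightarrow> j < card X")
    case True
    then show ?thesis
      using that inj_onD[OF bij_betw_imp_inj_on[OF h], of i j]
        inj_onD[OF bij_betw_imp_inj_on[OF k], of "i - card X" "j - card X"]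
      by (cases "i < card X") (auto simp: g_def not_less less_diff_conv2)
  next
    case False
    then show ?thesis
      using that gX[of i] gX[of j] gY[of i] gY[of j] assms(3) by (metis disjoint_iff not_le)
  qed
  then show ?thesis
    using that[of g] gX gY by (auto simp: inj_on_def)
qed

lemma has_induced_mono_complete_bipartite:
  assumes col: "two_edge_coloring n R B" and "X \<subseteq> {..<n}" "Y \<subseteq> {..<n}"
    and "clique X B" "clique Y B" and red: "\<And>x y. x \<in> X \<Longrightarrow> y \<in> Y \<Longrightarrow> {x, y} \<in> R"
  shows "has_induced_mono n R B (complete_bipartite (card X) (card Y))"
proof -
  note iff = two_edge_coloring_red_iff[OF col]
  have fin: "finite X" "finite Y"
    using assms finite_subset by blast+
  \<comment> \<open>A common vertex \<open>x\<close> would make the singleton \<open>{x, x}\<close>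
    a red edge.\<close>
  have "X \<inter> Y = {}"
    using red iff by blast
  then obtain g where g: "inj_on g {..<card X + card Y}" "\<And>i. i < card X \<Longrightarrow> g i \<in> X"
    "\<And>i. card X \<le> i \<Longrightarrow> i < card X + card Y \<Longrightarrow> g i \<in> Y"
    using enumerate_disjoint_union[OF fin] by metis
  have gXY: "g i \<in> X \<union> Y" if "i < card X + card Y" for i
    using that g(2,3)[of i] by (cases "i < card X") auto
  have gXY: "g i \<in> X \<union> Y" if "i < card X + card Y" for i
    using that g(2,3)[of i] by (cases "i < card X") auto
  have gXY: "g i \<in> X \<union> Y" if "i < card X + card Y" for i
    using that g(2,3)[of i] by (cases "i < card X") auto
  have gXY: "g i \<in> X \<union> Y" if "i < card X + card Y" for i
    using that g(2,3)[of i] by (cases "i < card X") auto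
  have gXY: "g i \<in> X \<union> Y" if "i < card X + card Y" for i
    using that g(2,3)[of i] by (cases "i < card X") auto
  have gXY: "g i \<in> X \<union> Y" if "i < card X + card Y" for i
    using that g(2,3)[of i] by (cases "i < card X") auto
  have gXY: "g i \<in> X \<union> Y" if "i < card X + card Y" for i
    using that g(2,3)[of i] by (cases "i < card X") auto
  have X: "{x, y} \<notin> R" if "x \<in> X" "y \<in> X" for x y
    using that \<open>clique X B\<close> iff unfolding clique_def by blast
  have Y: "{x, y} \<notin> R" if "x \<in> Y" "y \<in> Y" for x y
    using that \<open>clique Y B\<close> iff unfolding clique_def by blast
  show ?thesis
  proof (rule has_induced_mono_if_embedding[of g])
    show "g ` fst (complete_bipartite (card X) (card Y)) \<subseteq> {..<n}"
      using gXY assms(2,3) by (auto simp: complete_bipartite_def)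
  next
    fix i j
    assume "i \<in> fst (complete_bipartite (card X) (card Y))" "j \<in> fst (complete_bipartite (card X) (card Y))"
    then have ij: "i < card X + card Y" "j < card X + card Y"
      by (auto simp: complete_bipartite_def)
    have "{i, j} \<in> snd (complete_bipartite (card X) (card Y)) \<longleftrightarrow> (i < card X \<longleftrightarrow> \<not> j < card X)"
      using ij unfolding complete_bipartite_def snd_conv Un_iff doubleton_in_Collect_iff by auto
    also have "\<dots> \<longleftrightarrow> {g i, g j} \<in> R"
      using g(2)[of i] g(2)[of j] g(3)[of i] g(3)[of j] ij X[of "g i" "g j"] Y[of "g i" "g j"]
        red[of "g i" "g j"] red[of "g j" "g i"]
      by (cases "i < card X"; cases "j < card X") (simp_all add: insert_commute)
    finally show "{g i, g j} \<in> R \<longleftrightarrow> {i, j} \<in> snd (complete_bipartite (card X) (card Y))" ..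
  qed (use g in \<open>simp add: complete_bipartite_def\<close>)
qed

text \<open>The blue clique \<open>Y\<close> is the independent set of the red graph, and the red
  clique \<open>X\<close> is its clique side.\<close>

lemma has_induced_mono_complete_split:
  assumes col: "two_edge_coloring n R B" and "X \<subseteq> {..<n}" "Y \<subseteq> {..<n}"
    and "clique X R" "clique Y B" and red: "\<And>x y. x \<in> X \<Longrightarrow> y \<in> Y \<Longrightarrow> {x, y} \<in> R"
  shows "has_induced_mono n R B (complete_split (card X) (card Y))"
proof -
  note iff = two_edge_coloring_red_iff[OF col]
  have fin: "finite X" "finite Y"
    using assms finite_subset by blast+
  have "X \<inter> Y = {}"
    using red iff by blast
  then obtain g where g: "inj_on g {..<card X + card Y}" "\<And>i. i < card X \<Longrightarrow> g i \<in> X"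
    "\<And>i. card X \<le> i \<Longrightarrow> i < card X + card Y \<Longrightarrow> g i \<in> Y"
    using enumerate_disjoint_union[OF fin] by metis
  have gXY: "g i \<in> X \<union> Y" if "i < card X + card Y" for i
    using that g(2,3)[of i] by (cases "i < card X") auto
  have gXY: "g i \<in> X \<union> Y" if "i < card X + card Y" for i
    using that g(2,3)[of i] by (cases "i < card X") auto
  have gXY: "g i \<in> X \<union> Y" if "i < card X + card Y" for i
    using that g(2,3)[of i] by (cases "i < card X") auto
  have gXY: "g i \<in> X \<union> Y" if "i < card X + card Y" for i
    using that g(2,3)[of i] by (cases "i < card X") auto
  have gXY: "g i \<in> X \<union> Y" if "i < card X + card Y" for i
    using that g(2,3)[of i] by (cases "i < card X") auto
  have gXY: "g i \<in> X \<union> Y" if "i < card X + card Y" for i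
    using that g(2,3)[of i] by (cases "i < card X") auto
  have gXY: "g i \<in> X \<union> Y" if "i < card X + card Y" for i
    using that g(2,3)[of i] by (cases "i < card X") auto
  have X: "{x, y} \<in> R \<longleftrightarrow> x \<noteq> y" if "x \<in> X" "y \<in> X" for x y
    using that \<open>clique X R\<close> iff unfolding clique_def by blast
  have Y: "{x, y} \<notin> R" if "x \<in> Y" "y \<in> Y" for x y
    using that \<open>clique Y B\<close> iff unfolding clique_def by blast
  show ?thesis
  proof (rule has_induced_mono_if_embedding[of g])
    show "g ` fst (complete_split (card X) (card Y)) \<subseteq> {..<n}"
      using gXY assms(2,3) by (auto simp: complete_split_def)
  next
    fix i j
    assume "i \<in> fst (complete_split (card X) (card Y))" "j \<in> fst (complete_split (card X) (card Y))"
    then have ij: "i < card X + card Y" "j < card X + card Y"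
      by (auto simp: complete_split_def)
    have "{i, j} \<in> snd (complete_split (card X) (card Y)) \<longleftrightarrow> (i < card X \<or> j < card X) \<and> i \<noteq> j"
      using ij unfolding complete_split_def snd_conv Un_iff doubleton_in_Collect_iff by auto
    also have "\<dots> \<longleftrightarrow> {g i, g j} \<in> R"
      using g(2)[of i] g(2)[of j] g(3)[of i] g(3)[of j] ij X[of "g i" "g j"] Y[of "g i" "g j"]
        red[of "g i" "g j"] red[of "g j" "g i"] inj_onD[OF g(1), of i j]
      by (cases "i < card X"; cases "j < card X") (auto simp: insert_commute)
    finally show "{g i, g j} \<in> R \<longleftrightarrow> {i, j} \<in> snd (complete_split (card X) (card Y))" ..
  qed (use g in \<open>simp add: complete_split_def\<close>)
qed

section \<open>Induced and greedy matchings\<close>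

text \<open>The edges are indexed and their ends labelled, so that Ramsey's theorem can be applied
  to pairs of indices.\<close>

definition red_matching :: "nat set set \<Rightarrow> nat set \<Rightarrow> (nat \<Rightarrow> nat) \<Rightarrow> (nat \<Rightarrow> nat) \<Rightarrow> bool" where
  "red_matching R I a b \<longleftrightarrow> (\<forall>i\<in>I. {a i, b i} \<in> R) \<and>
     (\<forall>i\<in>I. \<forall>j\<in>I. i \<noteq> j \<longrightarrow> {a i, b i} \<inter> {a j, b j} = {})"

text \<open>The condition \<open>ind\<close> ranges over both orders of \<open>i\<close> and
  \<open>j\<close>, so it also excludes red pairs \<open>{b i, a j}\<close>.\<close>

lemma has_induced_mono_matching_graph:
  assumes col: "two_edge_coloring n R B" and m: "red_matching R {..<r} a b"
    and ind: "\<And>i j. i < r \<Longrightarrow> j < r \<Longrightarrow> i \<noteq> j \<Longrightarrow>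
      {a i, a j} \<notin> R \<and> {b i, b j} \<notin> R \<and> {a i, b j} \<notin> R"
  shows "has_induced_mono n R B (matching_graph r)"
proof -
  note iff = two_edge_coloring_red_iff[OF col]
  \<comment> \<open>In \<open>matching_graph\<close> the number \<open>k div 2\<close> is the index
    of the matching edge and the parity of \<open>k\<close> selects its end.\<close>
  define g where "g k = (if even k then a (k div 2) else b (k div 2))" for k
  have edge: "{a i, b i} \<in> R" "a i \<noteq> b i" "a i < n" "b i < n" if "i < r" for i
    using that m iff unfolding red_matching_def by blast+
  have disj: "a i \<noteq> a j" "b i \<noteq> b j" "a i \<noteq> b j" if "i < r" "j < r" "i \<noteq> j" for i j
    using that m unfolding red_matching_def by blast+
  have ne: "g i \<noteq> g j" if "i < 2 * r" "j < 2 * r" "i \<noteq> j" for i j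
  proof (cases "i div 2 = j div 2")
    case True
    then have "even i \<noteq> even j"
      using that by presburger
    then show ?thesis
      using True edge(2)[of "j div 2"] that by (auto simp: g_def)
  next
    case False
    then show ?thesis
      using disj[of "i div 2" "j div 2"] disj[of "j div 2" "i div 2"] that
      by (auto simp: g_def less_mult_imp_div_less mult.commute)
  qed
  have pair: "{i, j} \<in> snd (matching_graph r) \<longleftrightarrow> i div 2 = j div 2 \<and> i \<noteq> j"
    if "i < 2 * r" "j < 2 * r" for i j
  proof
    assume "i div 2 = j div 2 \<and> i \<noteq> j"
    then have "i div 2 < r \<and> {i, j} = {2 * (i div 2), 2 * (i div 2) + 1}"
      using that by (cases "even i"; cases "even j") (auto elim!: evenE oddE)
    then show "{i, j} \<in> snd (matching_graph r)"
      by (auto simp: matching_graph_def)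
  qed (auto simp: matching_graph_def doubleton_eq_iff)
  have col_pair: "{g i, g j} \<in> R \<longleftrightarrow> i div 2 = j div 2 \<and> i \<noteq> j"
    if "i < 2 * r" "j < 2 * r" for i j
  proof (cases "i div 2 = j div 2")
    case True
    have "{g i, g j} \<in> R \<longleftrightarrow> even i \<noteq> even j"
      using True edge(1)[of "j div 2"] that iff[of x x for x]
      by (auto simp: g_def insert_commute)
    moreover have "i \<noteq> j \<longleftrightarrow> even i \<noteq> even j"
      using True by presburger
    ultimately show ?thesis
      using True by simp
  next
    case False
    then show ?thesis
      using ind[of "i div 2" "j div 2"] ind[of "j div 2" "i div 2"] that
      by (auto simp: g_def insert_commute)
  qed
  show ?thesis
  proof (rule has_induced_mono_if_embedding[of g])
    show "inj_on g (fst (matching_graph r))"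
      using ne by (auto simp: inj_on_def matching_graph_def)
    show "g ` fst (matching_graph r) \<subseteq> {..<n}"
      using edge by (auto simp: g_def matching_graph_def)
  qed (use pair col_pair in \<open>auto simp: matching_graph_def\<close>)
qed

text \<open>Greedy choice: at most \<open>2 * n\<close> edges meet the ends of a chosen edge, which
  is exactly what the bound loses from \<open>Suc m\<close> to \<open>m\<close>.\<close>

lemma matching_if_many_edges:
  assumes "E \<subseteq> all_pairs {..<n}" "card E \<ge> 2 * n * m" "n > 0"
  shows "\<exists>a b. red_matching E {..<m} a b"
  using assms(1,2)
proof (induction m arbitrary: E)
  case 0
  then show ?case by (simp add: red_matching_def)
next
  case (Suc m)
  \<comment> \<open>An infinite set has \<open>card\<close> 0, but the assumed lower bound is
    positive.\<close>
  have finE: "finite E"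
    using Suc.prems(2) \<open>n > 0\<close> card.infinite by fastforce
  obtain e where "e \<in> E"
    using Suc.prems(2) \<open>n > 0\<close> by fastforce
  then obtain x y where xy: "{x, y} \<in> E"
    using Suc.prems(1) by (auto simp: all_pairs_def card_2_iff)
  \<comment> \<open>All edges through \<open>x\<close> or \<open>y\<close>; the singletons that are
    also in this set do not hurt, since only an upper bound on its size matters.\<close>
  let ?D = "(\<lambda>z. {x, z}) ` {..<n} \<union> (\<lambda>z. {y, z}) ` {..<n}"
  have "card ?D \<le> card ((\<lambda>z. {x, z}) ` {..<n}) + card ((\<lambda>z. {y, z}) ` {..<n})"
    by (rule card_Un_le)
  also have "\<dots> \<le> n + n"
    by (intro add_mono) (use card_image_le[of "{..<n}"] in force)+
  finally have "card (E - ?D) \<ge> 2 * n * m"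
    using Suc.prems(2) diff_card_le_card_Diff[of ?D E] by simp
  then obtain a b where ab: "red_matching (E - ?D) {..<m} a b"
    using Suc.IH[of "E - ?D"] Suc.prems(1) by blast
  \<comment> \<open>An edge outside \<open>?D\<close> avoids \<open>x\<close> and \<open>y\<close>
    because its ends are below \<open>n\<close>, the range of \<open>z\<close> in
    \<open>?D\<close>.\<close>
  have new: "{a i, b i} \<in> E \<and> {x, y} \<inter> {a i, b i} = {}" if "i < m" for i
  proof -
    have "{a i, b i} \<in> E - ?D"
      using ab that by (auto simp: red_matching_def)
    moreover from this have "a i < n" "b i < n"
      using Suc.prems(1) doubleton_in_all_pairs[of "a i" "b i" "{..<n}"] by blast+
    ultimately show ?thesis
      by (auto simp: insert_commute)
  qed
  have "red_matching E {..<Suc m} (a(m := x)) (b(m := y))"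
    using ab new xy unfolding red_matching_def lessThan_Suc by auto
  then show ?case by blast
qed

section \<open>Ramsey's theorem for ordered pairs of indices\<close>

text \<open>The colouring \<open>c\<close> may be asymmetric: each two-element set gets the colour
  of its increasing pair, so nothing is claimed about \<open>c j i\<close> for \<open>i < j\<close>.
  The list \<open>q\<close> prescribes a separate size for each colour.\<close>

lemma ramsey_ordered_pairs:
  "\<exists>N::nat. \<forall>c :: nat \<Rightarrow> nat \<Rightarrow> nat. (\<forall>i j. c i j < length q) \<longrightarrow>
    (\<exists>k < length q. \<exists>H \<subseteq> {..<N}. card H = q ! k \<and> (\<forall>i\<in>H. \<forall>j\<in>H. i < j \<longrightarrow> c i j = k))"
proof -
  obtain N :: nat where N: "partn_lst {..<N} q 2"
    using ramsey_full by blast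
  show ?thesis
  proof (rule exI[of _ N], intro allI impI)
    fix c :: "nat \<Rightarrow> nat \<Rightarrow> nat"
    assume c: "\<forall>i j. c i j < length q"
    define f where "f e = c (Min e) (Max e)" for e
    have "f \<in> [{..<N}]\<^bsup>2\<^esup> \<rightarrow> {..<length q}"
      using c by (simp add: f_def)
    then obtain k H where "k < length q" and H: "H \<in> [{..<N}]\<^bsup>(q ! k)\<^esup>" "f ` [H]\<^bsup>2\<^esup> \<subseteq> {k}"
      using partn_lstE[OF N] by metis
    moreover have "c i j = k" if "i \<in> H" "j \<in> H" "i < j" for i j
    proof -
      have "{i, j} \<in> [H]\<^bsup>2\<^esup>"
        using that by simp
      then have "f {i, j} = k"
        using H(2) by blast
      then show ?thesis
        using that by (simp add: f_def)
    qed
    moreover have "H \<subseteq> {..<N}" "card H = q ! k"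
      using H(1) by (auto simp: nsets_def)
    ultimately show "\<exists>k < length q. \<exists>H \<subseteq> {..<N}. card H = q ! k \<and> (\<forall>i\<in>H. \<forall>j\<in>H. i < j \<longrightarrow> c i j = k)"
      by blast
  qed
qed

text \<open>Homogeneity is known for increasing pairs only, so the two sides of a bipartite pattern
  need index sets with one entirely before the other. The induction moves the maximum into
  \<open>U\<close>.\<close>

lemma split_initial_segment:
  fixes H :: "nat set"
  assumes "finite H" "card H = p + q"
  obtains L U where "L \<subseteq> H" "U \<subseteq> H" "card L = p" "card U = q" "\<And>i j. i \<in> L \<Longrightarrow> j \<in> U \<Longrightarrow> i < j"
proof -
  have "\<exists>L \<subseteq> H. \<exists>U \<subseteq> H. card L = p \<and> card U = q \<and> (\<forall>i\<in>L. \<forall>j\<in>U. i < j)"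
    using assms
  proof (induction q arbitrary: H)
    case 0
    then show ?case by (intro exI[of _ H] conjI exI[of _ "{}"]) auto
  next
    case (Suc q)
    let ?m = "Max H"
    have m: "?m \<in> H" "finite H"
      using Suc.prems by (auto intro!: Max_in)
    then obtain L U where LU: "L \<subseteq> H - {?m}" "U \<subseteq> H - {?m}" "card L = p" "card U = q"
      "\<forall>i\<in>L. \<forall>j\<in>U. i < j"
      using Suc.IH[of "H - {?m}"] Suc.prems by auto
    have "\<forall>i\<in>L. i < ?m"
      using LU(1) m by (metis Diff_iff Max_ge insertCI le_neq_implies_less subsetD)
    moreover have "card (insert ?m U) = Suc q"
      using LU m by (metis Diff_iff card_insert_disjoint finite_Diff finite_subset insertCI subsetD)
    ultimately show ?case
      using LU m by (intro exI[of _ L] conjI exI[of _ "insert ?m U"]) auto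
  qed
  then show ?thesis
    using that by blast
qed

section \<open>From a large matching to one of three structures\<close>

lemma red_matching_trichotomy:
  "\<exists>M. \<forall>n R B a b. two_edge_coloring n R B \<longrightarrow> red_matching R {..<M} a b \<longrightarrow>
    has_induced_mono n R B (matching_graph r) \<or>
    has_induced_mono n R B (complete_bipartite s t) \<or>
    (\<exists>X \<subseteq> {..<n}. card X = N \<and> clique X R)"
proof -
  \<comment> \<open>Sizes for the colours 0 to 4 below: red cliques on the \<open>a\<close> or the
    \<open>b\<close> side, the two kinds of bipartite graph, and the induced matching.\<close>
  let ?q = "[N, N, s + t, s + t, r]"
  obtain M where M: "\<And>c :: nat \<Rightarrow> nat \<Rightarrow> nat. (\<forall>i j. c i j < length ?q) \<Longrightarrow>
    (\<exists>k < length ?q. \<exists>H \<subseteq> {..<M}. card H = ?q ! k \<and> (\<forall>i\<in>H. \<forall>j\<in>H. i < j \<longrightarrow> c i j = k))"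
    using ramsey_ordered_pairs[of ?q] by metis
  show ?thesis
  proof (intro exI[of _ M] allI impI)
    fix n R B a b
    assume col: "two_edge_coloring n R B" and m: "red_matching R {..<M} a b"
    note iff = two_edge_coloring_red_iff[OF col]
    \<comment> \<open>The colour names the first red pair in a fixed order. Pairs within a side are
      tested first, so colours from 2 on guarantee that both sides are blue, and colour 4 means that
      no pair is red.\<close>
    define c :: "nat \<Rightarrow> nat \<Rightarrow> nat" where "c i j =
      (if {a i, a j} \<in> R then 0 else if {b i, b j} \<in> R then 1 else
       if {a i, b j} \<in> R then 2 else if {b i, a j} \<in> R then 3 else 4)" for i j
    have "\<forall>i j. c i j < length ?q"
      by (simp add: c_def)
    from M[OF this] obtain k H where k: "k < length ?q" and H: "H \<subseteq> {..<M}" "card H = ?q ! k"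
      and hom: "\<And>i j. i \<in> H \<Longrightarrow> j \<in> H \<Longrightarrow> i < j \<Longrightarrow> c i j = k"
      by blast
    have finH: "finite H"
      using H(1) finite_subset by blast
    have bnd: "a i < n" "b i < n" if "i \<in> H" for i
      using that m H(1) iff unfolding red_matching_def by blast+
    have disj: "a i \<noteq> a j" "b i \<noteq> b j" "a i \<noteq> b j" if "i \<in> H" "j \<in> H" "i \<noteq> j" for i j
      using that m H(1) unfolding red_matching_def by blast+
    have inj: "inj_on a H" "inj_on b H"
      using disj unfolding inj_on_def by blast+
    have cliqueI: "clique (f ` H') E"
      if "H' \<subseteq> H" "\<And>i j. i \<in> H \<Longrightarrow> j \<in> H \<Longrightarrow> i < j \<Longrightarrow> {f i, f j} \<in> E" for f :: "nat \<Rightarrow> nat" and H' E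
      unfolding clique_def
    proof (clarify)
      fix i j assume "i \<in> H'" "j \<in> H'" "f i \<noteq> f j"
      then show "{f i, f j} \<in> E"
        using that by (metis insert_commute linorder_neqE_nat subsetD)
    qed
    \<comment> \<open>The choice \<open>(a, b)\<close> handles colour 2 and \<open>(b, a)\<close>
      colour 3. Cross pairs with decreasing indices are uncontrolled, hence the split into
      \<open>L\<close> before \<open>U\<close>.\<close>
    have bip: "has_induced_mono n R B (complete_bipartite s t)"
      if fg: "(f, g) \<in> {(a, b), (b, a)}" and card: "card H = s + t"
        and blue: "\<And>i j. i \<in> H \<Longrightarrow> j \<in> H \<Longrightarrow> i < j \<Longrightarrow> {a i, a j} \<in> B \<and> {b i, b j} \<in> B"
        and red: "\<And>i j. i \<in> H \<Longrightarrow> j \<in> H \<Longrightarrow> i < j \<Longrightarrow> {f i, g j} \<in> R" for f g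
    proof -
      obtain L U where LU: "L \<subseteq> H" "U \<subseteq> H" "card L = s" "card U = t" "\<And>i j. i \<in> L \<Longrightarrow> j \<in> U \<Longrightarrow> i < j"
        using split_initial_segment[OF finH card] by metis
      have "inj_on f L" "inj_on g U"
        using inj fg LU(1,2) inj_on_subset by blast+
      then have "card (f ` L) = s" "card (g ` U) = t"
        using LU by (auto simp: card_image)
      moreover have "clique (f ` L) B" "clique (g ` U) B"
        using fg blue by (auto intro!: cliqueI LU(1,2))
      moreover have "f ` L \<subseteq> {..<n}" "g ` U \<subseteq> {..<n}"
        using fg bnd LU(1,2) by auto
      moreover have "{x, y} \<in> R" if "x \<in> f ` L" "y \<in> g ` U" for x y
        using that red LU by blast
      ultimately show ?thesis
        using has_induced_mono_complete_bipartite[OF col, of "f ` L" "g ` U"] by simp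
    qed
    have big: "\<exists>X \<subseteq> {..<n}. card X = N \<and> clique X R"
      if "f \<in> {a, b}" "card H = N" "\<And>i j. i \<in> H \<Longrightarrow> j \<in> H \<Longrightarrow> i < j \<Longrightarrow> {f i, f j} \<in> R" for f
      using that inj bnd cliqueI[of H f R] by (intro exI[of _ "f ` H"]) (auto simp: card_image)
    \<comment> \<open>Not red means blue only for distinct vertices below \<open>n\<close>, which
      \<open>disj\<close> and \<open>bnd\<close> supply.\<close>
    have blue: "{a i, a j} \<in> B \<and> {b i, b j} \<in> B" if "k \<ge> 2" "i \<in> H" "j \<in> H" "i < j" for i j
      using that hom[of i j] iff[of "a i" "a j"] iff[of "b i" "b j"] bnd[of i] bnd[of j] disj[of i j]
      by (auto simp: c_def split: if_splits)
    have red: "(k = 0 \<longrightarrow> {a i, a j} \<in> R) \<and> (k = 1 \<longrightarrow> {b i, b j} \<in> R) \<and>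
      (k = 2 \<longrightarrow> {a i, b j} \<in> R) \<and> (k = 3 \<longrightarrow> {b i, a j} \<in> R)"
      if "i \<in> H" "j \<in> H" "i < j" for i j
      using hom[OF that] by (auto simp: c_def split: if_splits)
    consider "k = 0" | "k = 1" | "k = 2" | "k = 3" | "k = 4"
      using k by (auto simp: less_Suc_eq)
    then show "has_induced_mono n R B (matching_graph r) \<or>
      has_induced_mono n R B (complete_bipartite s t) \<or>
      (\<exists>X \<subseteq> {..<n}. card X = N \<and> clique X R)"
    proof cases
      case 1
      then have "\<exists>X \<subseteq> {..<n}. card X = N \<and> clique X R"
        using H(2) red by (intro big[of a]) auto
      then show ?thesis by simp
    next
      case 2
      then have "\<exists>X \<subseteq> {..<n}. card X = N \<and> clique X R"
        using H(2) red by (intro big[of b]) auto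
      then show ?thesis by simp
    next
      case 3
      then have "has_induced_mono n R B (complete_bipartite s t)"
        using H(2) red blue by (intro bip[of a b]) auto
      then show ?thesis by simp
    next
      case 4
      then have "has_induced_mono n R B (complete_bipartite s t)"
        using H(2) red blue by (intro bip[of b a]) auto
      then show ?thesis by simp
    next
      case 5
      \<comment> \<open>The bijection \<open>h\<close> need not be monotone: \<open>none\<close>
        covers both cross pairs, so it applies whichever of \<open>h i\<close> and
        \<open>h j\<close> is smaller.\<close>
      then obtain h where h: "bij_betw h {..<r} H"
        using H(2) finH ex_bij_betw_nat_finite[OF finH] by (auto simp: lessThan_atLeast0)
      have hH: "h i \<in> H" "h i < M" if "i < r" for i
        using that h H(1) by (auto simp: bij_betw_def)
      have hne: "h i \<noteq> h j" if "i < r" "j < r" "i \<noteq> j" for i j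
        using that h by (auto simp: bij_betw_def inj_on_def)
      have none: "{a i, a j} \<notin> R \<and> {b i, b j} \<notin> R \<and> {a i, b j} \<notin> R \<and> {b i, a j} \<notin> R"
        if "i \<in> H" "j \<in> H" "i < j" for i j
        using hom[OF that] 5 by (auto simp: c_def split: if_splits)
      have "has_induced_mono n R B (matching_graph r)"
      proof (rule has_induced_mono_matching_graph[OF col, of r "a \<circ> h" "b \<circ> h"])
        show "red_matching R {..<r} (a \<circ> h) (b \<circ> h)"
          using m hH hne unfolding red_matching_def by auto
      next
        fix i j assume "i < r" "j < r" "i \<noteq> j"
        then show "{(a \<circ> h) i, (a \<circ> h) j} \<notin> R \<and> {(b \<circ> h) i, (b \<circ> h) j} \<notin> R \<and> {(a \<circ> h) i, (b \<circ> h) j} \<notin> R"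
          using none[of "h i" "h j"] none[of "h j" "h i"] hH(1) hne[of i j]
          by (metis comp_apply insert_commute linorder_neqE_nat)
      qed
      then show ?thesis by simp
    qed
  qed
qed

section \<open>Complete split graphs from two cliques\<close>

text \<open>Number both cliques and colour \<open>(i, j)\<close> by the colour of the edge between
  vertex \<open>i\<close> of one and vertex \<open>j\<close> of the other. A homogeneous set of
  \<open>t + t\<close> indices, cut into a lower and an upper half, gives \<open>t\<close> vertices
  in each clique with a single colour in between.\<close>

lemma clique_pair_complete_split:
  "\<exists>N. \<forall>n R B X Y. two_edge_coloring n R B \<longrightarrow> X \<subseteq> {..<n} \<longrightarrow> Y \<subseteq> {..<n} \<longrightarrow>
    card X = N \<longrightarrow> card Y = N \<longrightarrow> clique X R \<longrightarrow> clique Y B \<longrightarrow>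
    has_induced_mono n R B (complete_split t t)"
proof -
  let ?q = "[t + t, t + t]"
  obtain M where M: "\<And>c :: nat \<Rightarrow> nat \<Rightarrow> nat. (\<forall>i j. c i j < length ?q) \<Longrightarrow>
    (\<exists>k < length ?q. \<exists>H \<subseteq> {..<M}. card H = ?q ! k \<and> (\<forall>i\<in>H. \<forall>j\<in>H. i < j \<longrightarrow> c i j = k))"
    using ramsey_ordered_pairs[of ?q] by metis
  show ?thesis
  \<comment> \<open>One vertex more than Ramsey's theorem requires, to make up for a possible common
    vertex.\<close>
  proof (intro exI[of _ "Suc M"] allI impI)
    fix n R B X Y
    assume col: "two_edge_coloring n R B" and sub: "X \<subseteq> {..<n}" "Y \<subseteq> {..<n}"
      and card: "card X = Suc M" "card Y = Suc M" and cl: "clique X R" "clique Y B"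
    note iff = two_edge_coloring_red_iff[OF col]
    have fin: "finite X" "finite Y"
      using sub finite_subset by blast+
    \<comment> \<open>The edge joining two distinct common vertices would be both red and
      blue.\<close>
    have "x = y" if "x \<in> X \<inter> Y" "y \<in> X \<inter> Y" for x y
      using that cl iff unfolding clique_def by blast
    then have "card (X \<inter> Y) \<le> 1"
      using fin by (simp add: card_le_Suc0_iff_eq)
    then have "M \<le> card (Y - X)"
      using card fin card_Diff_subset_Int[of Y X] by (simp add: Int_commute)
    then obtain Y' where Y': "Y' \<subseteq> Y - X" "card Y' = M"
      by (meson obtain_subset_with_card_n)
    obtain X' where X': "X' \<subseteq> X" "card X' = M"
      using card(1) obtain_subset_with_card_n[of M X] by auto
    have "finite X'" "finite Y'"
      using X' Y' fin finite_subset by blast+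
    then obtain f g where f: "bij_betw f {..<M} X'" and g: "bij_betw g {..<M} Y'"
      using X' Y' ex_bij_betw_nat_finite lessThan_atLeast0 by metis
    define c :: "nat \<Rightarrow> nat \<Rightarrow> nat" where "c i j = (if {f i, g j} \<in> R then 0 else 1)" for i j
    have "\<forall>i j. c i j < length ?q"
      by (simp add: c_def)
    from M[OF this] obtain k H where k: "k < length ?q" and H: "H \<subseteq> {..<M}" "card H = ?q ! k"
      and hom: "\<And>i j. i \<in> H \<Longrightarrow> j \<in> H \<Longrightarrow> i < j \<Longrightarrow> c i j = k"
      by blast
    have cardH: "card H = t + t"
      using H(2) k by (auto simp: less_Suc_eq)
    obtain L U where LU: "L \<subseteq> H" "U \<subseteq> H" "card L = t" "card U = t" "\<And>i j. i \<in> L \<Longrightarrow> j \<in> U \<Longrightarrow> i < j"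
      using split_initial_segment[OF finite_subset[OF H(1) finite_lessThan] cardH] by blast
    have "inj_on f L" "inj_on g U"
      using bij_betw_imp_inj_on[OF f] bij_betw_imp_inj_on[OF g] LU(1,2) H(1)
      by (meson inj_on_subset subset_trans)+
    then have cards: "card (f ` L) = t" "card (g ` U) = t"
      using LU by (auto simp: card_image)
    have "f ` L \<subseteq> X'" "g ` U \<subseteq> Y'"
      using bij_betw_imp_surj_on[OF f] bij_betw_imp_surj_on[OF g] LU(1,2) H(1)
      by (metis image_mono subset_trans)+
    then have in': "f ` L \<subseteq> X" "g ` U \<subseteq> Y - X"
      using X'(1) Y'(1) by (meson subset_trans)+
    then have "g ` U \<subseteq> Y"
      by (meson Diff_subset subset_trans)
    then have cl': "clique (f ` L) R" "clique (g ` U) B"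
      using cl in'(1) by (meson smaller_clique)+
    have sub': "f ` L \<subseteq> {..<n}" "g ` U \<subseteq> {..<n}"
      using \<open>g ` U \<subseteq> Y\<close> in'(1) sub by (meson subset_trans)+
    have mono: "{x, y} \<in> R \<longleftrightarrow> k = 0" if xy: "x \<in> f ` L" "y \<in> g ` U" for x y
    proof -
      obtain i j where ij: "i \<in> L" "j \<in> U" "x = f i" "y = g j"
        using xy by blast
      then have "c i j = k"
        using LU hom by blast
      then show ?thesis
        unfolding ij(3,4) c_def by (auto split: if_splits)
    qed
    show "has_induced_mono n R B (complete_split t t)"
    proof (cases "k = 0")
      case True
      then have "{x, y} \<in> R" if "x \<in> f ` L" "y \<in> g ` U" for x y
        using that mono by blast
      then show ?thesis
        using has_induced_mono_complete_split[OF col sub' cl'] cards by simp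
    next
      case False
      \<comment> \<open>With blue in between the roles are exchanged: the blue clique
        \<open>g\<close> U\<open>becomes the clique side of a blue split graph and\<close>f
        \<open>L\<close> its independent side.\<close>
      have "{y, x} \<in> B" if xy: "x \<in> f ` L" "y \<in> g ` U" for x y
      proof -
        have "{x, y} \<notin> R"
          using xy mono False by blast
        moreover have "x \<noteq> y" "x < n" "y < n"
          using subsetD[OF in'(1) xy(1)] subsetD[OF in'(2) xy(2)]
            subsetD[OF sub'(1) xy(1)] subsetD[OF sub'(2) xy(2)] by auto
        ultimately show ?thesis
          using iff[of x y] by (simp add: insert_commute)
      qed
      then have "has_induced_mono n B R (complete_split t t)"
        using has_induced_mono_complete_split[OF _ sub'(2,1) cl'(2,1)]
          col[unfolded two_edge_coloring_commute[of n R]] cards by simp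
      then show ?thesis
        by (subst has_induced_mono_commute)
    qed
  qed
qed

section \<open>Combining both colours\<close>

theorem theorem2p6:
  fixes r s t :: nat
  assumes "r \<ge> 2" and "s \<ge> 2" and "t \<ge> s"
  shows "\<exists>C::real. \<exists>n0::nat. \<forall>n\<ge>n0. \<forall>R B.
    two_edge_coloring n R B \<and>
    real (min (card R) (card B)) \<ge> C * real n \<and>
    \<not> has_induced_mono n R B (matching_graph r) \<longrightarrow>
    (\<exists>H \<in> family_F s t. has_induced_mono n R B H)"
proof -
  obtain N where N: "\<And>n R B X Y. two_edge_coloring n R B \<Longrightarrow> X \<subseteq> {..<n} \<Longrightarrow> Y \<subseteq> {..<n} \<Longrightarrow>
    card X = N \<Longrightarrow> card Y = N \<Longrightarrow> clique X R \<Longrightarrow> clique Y B \<Longrightarrow>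
    has_induced_mono n R B (complete_split t t)"
    using clique_pair_complete_split[of t] by metis
  obtain M where M: "\<And>n R B a b. two_edge_coloring n R B \<Longrightarrow> red_matching R {..<M} a b \<Longrightarrow>
    has_induced_mono n R B (matching_graph r) \<or>
    has_induced_mono n R B (complete_bipartite s t) \<or>
    (\<exists>X \<subseteq> {..<n}. card X = N \<and> clique X R)"
    using red_matching_trichotomy[of r s t N] by metis
  show ?thesis
  \<comment> \<open>\<open>C\<close> is the density at which the greedy argument yields
    \<open>M\<close> matching edges; \<open>n0 = 1\<close> ensures \<open>n > 0\<close>
    there.\<close>
  proof (intro exI[of _ "real (2 * M)"] exI[of _ 1] allI impI, elim conjE)
    fix n R B
    assume n: "1 \<le> n" and col: "two_edge_coloring n R B"
      and edges: "real (2 * M) * real n \<le> real (min (card R) (card B))"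
      and no: "\<not> has_induced_mono n R B (matching_graph r)"
    \<comment> \<open>Stated for arbitrary \<open>R\<close> and \<open>B\<close>, so that it can be
      applied again with the colours exchanged.\<close>
    have clq: "has_induced_mono n R B (complete_bipartite s t) \<or>
      (\<exists>X \<subseteq> {..<n}. card X = N \<and> clique X R)"
      if col: "two_edge_coloring n R B" and many: "2 * n * M \<le> card R"
        and no: "\<not> has_induced_mono n R B (matching_graph r)" for R B
    proof -
      have "R \<subseteq> all_pairs {..<n}"
        using col by (auto simp: two_edge_coloring_def)
      then obtain a b where "red_matching R {..<M} a b"
        using matching_if_many_edges[of R n M] many n by auto
      then show ?thesis
        using M[OF col] no by blast
    qed
    have "real (2 * n * M) \<le> real (min (card R) (card B))"
      using edges by (simp add: mult_ac)
    then have "2 * n * M \<le> min (card R) (card B)"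
      by (simp only: of_nat_le_iff)
    then have many: "2 * n * M \<le> card R" "2 * n * M \<le> card B"
      by simp_all
    \<comment> \<open>If neither colour yields the bipartite graph, \<open>clq\<close> gives a red
      and a blue clique of size \<open>N\<close>, to which \<open>N\<close> applies.\<close>
    have "has_induced_mono n R B (complete_bipartite s t) \<or> has_induced_mono n R B (complete_split t t)"
      using clq[OF col many(1) no] clq[of B R] many(2) col no N[OF col]
      by (metis two_edge_coloring_commute has_induced_mono_commute)
    then show "\<exists>H \<in> family_F s t. has_induced_mono n R B H"
      by (auto simp: family_F_def)
  qed
qed

end
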